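(* Let $x$ and $k$ be indeterminates and let $A_n^{(k)}(x)$, $n\ge 0$, be the $1/k$-Eulerian polynomials. Then for all $n\ge 0$ $$A_n^{(k)}(x)=\sum_{m=0}^n\sum_{j=0}^n S_{n,j}\,(x-1)^{n-j}\,|s_{j,m}|\,k^{n-m},$$ where $S_{n,j}$ are the Stirling numbers of the second kind and $|s_{j,m}|$ are the unsigned Stirling numbers of the first kind.
   Context: The Savage-Viswanathan polynomials $F_n(x,y)$ are defined by the exponential generating function $\sum_{n\ge 0}F_n(x,y)\frac{z^n}{n!}=\left(\frac{1-x}{e^{z(x-1)}-x}\right)^y$ (a formal power series in $z$; the base has constant term $1$, and $u^y=\exp(y\ln u)$). They are polynomials in $x,y$. The $1/k$-Eulerian polynomials are $A_n^{(k)}(x)=k^nF_n(x,1/k)$. Conventions: $S_{0,0}=|s_{0,0}|=1$, and $|s_{j,m}|=0$ for $m>j$. *)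

theory Defs
  imports
    "HOL-Computational_Algebra.Formal_Power_Series"
    "HOL-Computational_Algebra.Polynomial_Factorial"
    "HOL-Combinatorics.Stirling"
begin

unbundle fps_syntax

(* Bivariate polynomials over the rationals are rendered as rat poly poly: the inner variable is
   the first indeterminate (x), the outer variable the second one (y or k, depending on context). *)
type_synonym qpoly2 = "rat poly poly"
type_synonym qrat2 = "rat poly poly fract"

definition ind1 :: qrat2 where "ind1 = to_fract [:[:0, 1:]:]"
definition ind2 :: qrat2 where "ind2 = to_fract [:0, 1:]"

definition poly2_eval :: "qpoly2 \<Rightarrow> 'a::field_char_0 \<Rightarrow> 'a \<Rightarrow> 'a" where
  "poly2_eval p a b = poly (map_poly (\<lambda>c. poly (map_poly of_rat c) a) p) b"

(* u^c = exp (c * ln u), meaningful for series u with constant term 1;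
   fps_ln 1 is the expansion of ln (1 + z). *)
definition fps_pow :: "'a::field_char_0 fps \<Rightarrow> 'a \<Rightarrow> 'a fps" where
  "fps_pow u c = fps_exp 1 oo (fps_const c * (fps_ln 1 oo (u - 1)))"

definition SV_base :: "'a::field_char_0 \<Rightarrow> 'a fps" where
  "SV_base x = fps_const (1 - x) / (fps_exp (x - 1) - fps_const x)"

definition SV_egf :: "qrat2 fps" where
  "SV_egf = fps_pow (SV_base ind1) ind2"

definition SV_poly :: "nat \<Rightarrow> qpoly2" where
  "SV_poly n = (THE p. to_fract p / fact n = SV_egf $ n)"

definition inv_k_Eulerian :: "nat \<Rightarrow> 'a::field_char_0 \<Rightarrow> 'a \<Rightarrow> 'a" where
  "inv_k_Eulerian n k x = k ^ n * poly2_eval (SV_poly n) x (1 / k)"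

(* The description in SV_poly is proper: the coefficients of SV_egf are polynomials
   (lemma to_fract_SV_poly). *)

lemma of_nat_to_fract: "of_nat n = to_fract (of_nat n)"
  by (induction n) auto

definition polyc :: "qrat2 fps \<Rightarrow> bool" where
  "polyc f \<longleftrightarrow> (\<forall>n. f $ n \<in> range to_fract)"

lemma rangeI_mult: "a \<in> range to_fract \<Longrightarrow> b \<in> range to_fract \<Longrightarrow> a * b \<in> range to_fract"
  by (auto simp flip: to_fract_mult)

lemma rangeI_add: "a \<in> range to_fract \<Longrightarrow> b \<in> range to_fract \<Longrightarrow> a + b \<in> range to_fract"
  by (auto simp flip: to_fract_add)

lemma rangeI_uminus: "a \<in> range to_fract \<Longrightarrow> - a \<in> range to_fract"
  by (auto simp flip: to_fract_uminus)

lemma rangeI_sum: "(\<And>i. i \<in> A \<Longrightarrow> f i \<in> range to_fract) \<Longrightarrow> sum f A \<in> range to_fract"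
proof (induction A rule: infinite_finite_induct)
  case (insert a A)
  then show ?case by (simp add: rangeI_add)
qed (metis rangeI sum.infinite sum.empty to_fract_0)+

lemma rangeI_power: "a \<in> range to_fract \<Longrightarrow> a ^ n \<in> range to_fract"
proof (induction n)
  case 0
  show ?case by (metis power_0 rangeI to_fract_1)
next
  case (Suc n)
  then show ?case by (simp add: rangeI_mult)
qed

lemma inverse_of_nat_range: "inverse (of_nat n) \<in> range (to_fract :: qpoly2 \<Rightarrow> qrat2)"
proof (cases "n = 0")
  case True
  then show ?thesis by (metis inverse_zero of_nat_0 rangeI to_fract_0)
next
  case False
  let ?q = "[:[:inverse (of_nat n):]:] :: qpoly2"
  have "of_nat n * ?q = 1"
    using False by (simp add: of_nat_poly one_pCons)
  then have "of_nat n * to_fract ?q = (1::qrat2)"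
    by (metis of_nat_to_fract to_fract_1 to_fract_mult)
  then have "inverse (of_nat n) = to_fract ?q"
    by (rule inverse_unique)
  then show ?thesis by simp
qed

lemma polyc_mult: "polyc f \<Longrightarrow> polyc g \<Longrightarrow> polyc (f * g)"
  by (auto simp: polyc_def fps_mult_nth intro!: rangeI_sum rangeI_mult)

lemma polyc_1: "polyc 1"
  unfolding polyc_def by (metis fps_one_nth rangeI to_fract_0 to_fract_1)

lemma polyc_power: "polyc f \<Longrightarrow> polyc (f ^ n)"
  by (induction n) (simp_all add: polyc_mult polyc_1)

lemma polyc_compose: "polyc f \<Longrightarrow> polyc g \<Longrightarrow> polyc (f oo g)"
  using polyc_power[of g]
  by (auto simp: polyc_def fps_compose_nth intro!: rangeI_sum rangeI_mult)

lemma ind1_neq_1: "ind1 \<noteq> 1"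
proof
  assume "ind1 = 1"
  then have "to_fract [:[:0, 1:]:] = to_fract (1::qpoly2)" by (simp add: ind1_def)
  then show False by (simp only: to_fract_eq_iff) (simp add: one_pCons)
qed

lemma polyc_SV_base: "polyc (SV_base ind1)" and SV_base_0: "SV_base ind1 $ 0 = 1"
proof -
  let ?u = "SV_base ind1"
  let ?d = "fps_exp (ind1 - 1) - fps_const ind1"
  have ne: "ind1 - 1 \<noteq> 0" using ind1_neq_1 by simp
  have d0: "?d $ 0 \<noteq> 0" using ne by simp
  have eq: "?u * ?d = fps_const (1 - ind1)"
  proof -
    have "?u = fps_const (1 - ind1) * inverse ?d"
      unfolding SV_base_def by (rule fps_divide_unit[OF d0])
    then show ?thesis using inverse_mult_eq_1[OF d0] by (simp add: mult.assoc)
  qed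
  have "?u $ 0 * ?d $ 0 = 1 - ind1"
    using arg_cong[OF eq, of "\<lambda>f. f $ 0"] by simp
  then have u0: "?u $ 0 = 1" using ne by simp
  have x: "ind1 - 1 \<in> range to_fract"
    unfolding ind1_def by (metis rangeI to_fract_1 to_fract_diff)
  have "?u $ n \<in> range to_fract" for n
  proof (induction n rule: less_induct)
    case (less n)
    show ?case
    proof (cases "n = 0")
      case True
      then show ?thesis using u0 by (metis rangeI to_fract_1)
    next
      case False
      have "(\<Sum>i=0..n. ?u $ i * ?d $ (n - i)) = 0"
        using arg_cong[OF eq, of "\<lambda>f. f $ n"] False by (simp add: fps_mult_nth del: fps_sub_nth)
      moreover have "{0..n} = insert n {0..<n}" by auto
      ultimately have "?u $ n * ?d $ 0 + (\<Sum>i=0..<n. ?u $ i * ?d $ (n - i)) = 0"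
        by (simp del: fps_sub_nth)
      moreover have "?d $ (n - i) = (ind1 - 1) * ((ind1 - 1) ^ (n - i - 1) * inverse (of_nat (fact (n - i))))"
        if "i < n" for i
        using that by (cases "n - i") (simp_all add: divide_inverse)
      ultimately have "?u $ n * ?d $ 0 + (\<Sum>i=0..<n. ?u $ i *
          ((ind1 - 1) * ((ind1 - 1) ^ (n - i - 1) * inverse (of_nat (fact (n - i)))))) = 0"
        by (simp del: fps_sub_nth)
      then have "(ind1 - 1) * (?u $ n) = (ind1 - 1) * (\<Sum>i=0..<n. ?u $ i *
          ((ind1 - 1) ^ (n - i - 1) * inverse (of_nat (fact (n - i)))))"
        by (simp add: sum_distrib_left algebra_simps)
      then have "?u $ n = (\<Sum>i=0..<n. ?u $ i *
          ((ind1 - 1) ^ (n - i - 1) * inverse (of_nat (fact (n - i)))))"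
        using ne mult_left_cancel by blast
      moreover have "\<dots> \<in> range to_fract"
        by (intro rangeI_sum rangeI_mult rangeI_power x inverse_of_nat_range less.IH) auto
      ultimately show ?thesis by simp
    qed
  qed
  then show "polyc ?u" by (simp add: polyc_def)
  show "?u $ 0 = 1" by (rule u0)
qed

lemma polyc_SV_egf: "polyc SV_egf"
proof -
  have e: "polyc (fps_exp 1)"
    using inverse_of_nat_range[of "fact _"] by (simp add: polyc_def divide_inverse)
  have "1 \<in> range (to_fract :: qpoly2 \<Rightarrow> qrat2)" "0 \<in> range (to_fract :: qpoly2 \<Rightarrow> qrat2)"
    by (metis rangeI to_fract_1, metis rangeI to_fract_0)
  note r = this
  have l: "polyc (fps_ln 1)"
    using r by (auto simp: polyc_def fps_ln_nth divide_inverse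
        intro!: rangeI_mult rangeI_power rangeI_uminus inverse_of_nat_range)
  have b: "polyc (SV_base ind1 - 1)"
    unfolding polyc_def
  proof
    fix n
    have "SV_base ind1 $ n \<in> range to_fract" using polyc_SV_base by (simp add: polyc_def)
    moreover have "- ((1 :: qrat2 fps) $ n) \<in> range to_fract"
      using r by (simp add: rangeI_uminus)
    ultimately show "(SV_base ind1 - 1) $ n \<in> range to_fract"
      using rangeI_add[of "SV_base ind1 $ n" "- ((1 :: qrat2 fps) $ n)"]
      by (simp only: fps_sub_nth diff_conv_add_uminus[of "SV_base ind1 $ n"])
  qed
  have c: "polyc (fps_const ind2)"
    unfolding polyc_def
  proof
    fix n
    show "fps_const ind2 $ n \<in> range to_fract"
      using r by (cases "n = 0") (simp_all only: fps_nth_fps_const ind2_def rangeI if_True if_False simp_thms)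
  qed
  show ?thesis
    unfolding SV_egf_def fps_pow_def by (intro polyc_compose polyc_mult e l b c)
qed

lemma to_fract_SV_poly: "to_fract (SV_poly n) / fact n = SV_egf $ n"
proof -
  obtain p where p: "SV_egf $ n = to_fract p"
    using polyc_SV_egf by (auto simp: polyc_def)
  have f: "(fact n :: qrat2) = to_fract (of_nat (fact n))"
    by (metis of_nat_fact of_nat_to_fract)
  have nz: "(fact n :: qrat2) \<noteq> 0" by simp
  have "\<exists>!q. to_fract q / fact n = SV_egf $ n"
  proof
    show "to_fract (of_nat (fact n) * p) / fact n = SV_egf $ n"
      using nz p f by (metis nonzero_mult_div_cancel_left to_fract_mult)
  next
    fix q
    assume "to_fract q / fact n = SV_egf $ n"
    then have "to_fract q = to_fract (of_nat (fact n) * p)"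
      using nz p f by (metis nonzero_divide_eq_eq mult.commute to_fract_mult)
    then show "q = of_nat (fact n) * p" by (simp only: to_fract_eq_iff)
  qed
  then show ?thesis unfolding SV_poly_def by (rule theI')
qed

end

(* Put t = x - 1 and w = (exp (t z) - 1) / t. The base of the generating function is 1 / (1 - w),
   so the generating function is the binomial series of (1 - w)^(-y), i.e. the sum over j of
   (y rising j) w^j / j!. Here w^j / j! generates the S_{n,j} t^(n-j), because w' = 1 + t w, and the
   rising factorial of y expands in powers of y with coefficients |s_{j,m}|. *)
theory Submission
  imports Defs
begin

text \<open>Substitution is associative and multiplicative, so it passes through the logarithm and
  the exponential. The two hypotheses make the inner series \<open>g\<close> and
  \<open>u - 1\<close> vanish at 0, as associativity requires.\<close>

lemma fps_pow_compose:
  assumes "u $ 0 = 1" "g $ 0 = 0"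
  shows "fps_pow (u oo g) c = fps_pow u c oo g"
proof -
  let ?L = "fps_const c * (fps_ln 1 oo (u - 1))"
  have "(u oo g) - 1 = (u - 1) oo g"
    by (simp add: fps_compose_sub_distrib)
  then have "fps_const c * (fps_ln 1 oo ((u oo g) - 1)) = ?L oo g"
    using assms by (simp add: fps_compose_assoc fps_compose_mult_distrib)
  moreover have "fps_exp 1 oo (?L oo g) = fps_exp 1 oo ?L oo g"
    using assms by (intro fps_compose_assoc) simp_all
  ultimately show ?thesis
    unfolding fps_pow_def by (simp only:)
qed

text \<open>Both sides solve f' = -c f / (1 + X) with f(0) = 1, and that solution is unique.\<close>

lemma fps_pow_inverse_one_plus_X:
  "fps_pow (inverse (1 + fps_X)) c = fps_binomial (- c :: 'a::field_char_0)"
proof -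
  define I :: "'a fps" where "I = inverse (1 + fps_X)"
  have I: "I * (1 + fps_X) = 1"
    unfolding I_def by (rule inverse_mult_eq_1) simp
  have I0: "I $ 0 = 1"
    by (simp add: I_def)
  \<comment> \<open>The derivative of \<open>fps_ln 1\<close> is 1/(1 + X), so the chain rule for ln
    I needs this series at I - 1.\<close>
  have "inverse (1 + fps_X) oo (I - 1) = inverse I"
    using I0 by (subst fps_inverse_compose) (simp_all add: fps_compose_add_distrib)
  also have "\<dots> = 1 + fps_X"
    by (simp add: I_def)
  finally have comp: "inverse (1 + fps_X) oo (I - 1) = 1 + fps_X" .
  let ?L = "fps_const c * (fps_ln 1 oo (I - 1))"
  have "fps_deriv (fps_ln 1 oo (I - 1)) = (1 + fps_X) * fps_deriv I"
    using I0 by (simp add: fps_compose_deriv fps_ln_deriv comp)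
  also have "fps_deriv I = - (I * I)"
    by (simp add: I_def fps_inverse_deriv power2_eq_square)
  also have "(1 + fps_X) * - (I * I) = - ((1 + fps_X) * (I * I))"
    by (rule mult_minus_right)
  also have "(1 + fps_X) * (I * I) = I * (1 + fps_X) * I"
    by (simp only: mult_ac)
  also have "\<dots> = I"
    by (simp only: I mult_1_left)
  finally have "fps_deriv ?L = fps_const (- c) * I"
    by (simp flip: fps_const_neg)
  then have "fps_deriv (fps_pow I c) = fps_const (- c) * fps_pow I c / (1 + fps_X)"
    unfolding fps_pow_def
    by (subst fps_compose_deriv)
      (simp_all add: I0 fps_divide_unit flip: I_def)
  moreover have "fps_pow I c $ 0 = 1"
    by (simp add: fps_pow_def)
  ultimately show ?thesis
    unfolding I_def using fps_binomial_ODE_unique' by blast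
qed

text \<open>The differential equation gives (w^j)' = j (w^(j-1) + t w^j). Comparing coefficients,
  this is the recurrence S(n+1, j) = S(n, j-1) + j S(n, j).\<close>

lemma fps_power_nth_Stirling:
  fixes t :: "'a::field_char_0"
  assumes "w $ 0 = 0" and w': "fps_deriv w = 1 + fps_const t * w"
  shows "w ^ j $ n = fact j * of_nat (Stirling n j) * t ^ (n - j) / fact n"
proof (induction n arbitrary: j)
  case 0
  then show ?case using assms(1) by (cases j) simp_all
next
  case (Suc n)
  show ?case
  proof (cases j)
    case 0
    then show ?thesis by simp
  next
    case (Suc i)
    have "fps_deriv (w ^ j) = of_nat j * fps_deriv w * w ^ i"
      unfolding fps_deriv_power' Suc by simp
    also have "\<dots> = of_nat j * (w ^ i + fps_const t * w ^ j)"
      by (simp add: Suc w' algebra_simps del: of_nat_Suc)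
    finally have "fps_deriv (w ^ j) = of_nat j * (w ^ i + fps_const t * w ^ j)" .
    from arg_cong[OF this, of "\<lambda>f. f $ n"]
    have rec: "of_nat (Suc n) * (w ^ j $ Suc n) = of_nat j * (w ^ i $ n + t * (w ^ j $ n))"
      by (simp del: of_nat_Suc flip: fps_of_nat)
    \<comment> \<open>Subtraction is truncated: the exponents agree only for j \<le> n, and for j >
      n the Stirling number vanishes.\<close>
    have pow: "of_nat (Stirling n j) * (t * t ^ (n - j)) = of_nat (Stirling n j) * t ^ (n - i)"
    proof (cases "j \<le> n")
      case True
      then have "n - i = Suc (n - j)" using Suc by simp
      then show ?thesis by simp
    qed simp
    have "of_nat (Suc n) * (w ^ j $ Suc n) = of_nat j *
        (fact i * of_nat (Stirling n i) * t ^ (n - i)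
          + fact j * (of_nat (Stirling n j) * (t * t ^ (n - j)))) / fact n"
      unfolding rec Suc.IH by (simp add: field_simps)
    also have "\<dots> = fact j * of_nat (Stirling (Suc n) j) * t ^ (Suc n - j) / fact n"
      unfolding pow by (simp add: Suc algebra_simps)
    finally show ?thesis
      by (simp add: field_simps del: of_nat_Suc)
  qed
qed

text \<open>The denominator factors as (1 - x)(1 - w), and 1 - x cancels. The form with 1 + X and
  inner series -w fits \<open>fps_pow_compose\<close> and the binomial series.\<close>

lemma SV_base_eq_compose:
  fixes x :: "'a::field_char_0"
  assumes "x \<noteq> 1"
  shows "SV_base x = inverse (1 + fps_X) oo - (fps_const (1 / (x - 1)) * (fps_exp (x - 1) - 1))"
proof -
  define w where "w = fps_const (1 / (x - 1)) * (fps_exp (x - 1) - 1)"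
  have w0: "(- w) $ 0 = 0" by (simp add: w_def)
  have "fps_const (1 - x) * w = 1 - fps_exp (x - 1)"
  proof -
    have "fps_const (1 - x) * w = fps_const ((1 - x) * (1 / (x - 1))) * (fps_exp (x - 1) - 1)"
      unfolding w_def mult.assoc[symmetric] by simp
    also have "(1 - x) * (1 / (x - 1)) = -1"
      using assms by (simp add: field_simps)
    finally show ?thesis by (simp flip: fps_const_neg)
  qed
  then have d: "fps_exp (x - 1) - fps_const x = fps_const (1 - x) * (1 - w)"
    by (simp add: right_diff_distrib flip: fps_const_sub)
  have "SV_base x = fps_const (1 - x) * inverse (fps_const (1 - x) * (1 - w))"
    unfolding SV_base_def d using assms w0 by (intro fps_divide_unit) simp
  also have "\<dots> = inverse (1 - w)"
    using assms by (simp add: fps_inverse_mult fps_const_inverse mult.assoc[symmetric])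
  also have "\<dots> = inverse (1 + fps_X) oo (- w)"
    using w0 by (subst fps_inverse_compose) (simp_all add: fps_compose_add_distrib)
  finally show ?thesis by (simp add: w_def)
qed

lemma fps_pow_SV_base_nth:
  fixes x :: "'a::field_char_0"
  assumes "x \<noteq> 1"
  shows "fact n * fps_pow (SV_base x) y $ n =
    (\<Sum>j=0..n. of_nat (Stirling n j) * (x - 1) ^ (n - j) * pochhammer y j)"
proof -
  define w where "w = fps_const (1 / (x - 1)) * (fps_exp (x - 1) - 1)"
  have w0: "w $ 0 = 0" by (simp add: w_def)
  have "fps_const (x - 1) * w = fps_exp (x - 1) - 1"
    using assms by (simp add: w_def mult.assoc[symmetric] del: fps_const_sub)
  moreover have "fps_deriv w = fps_exp (x - 1)"
    using assms by (simp add: w_def mult.assoc[symmetric] del: fps_const_sub)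
  ultimately have w': "fps_deriv w = 1 + fps_const (x - 1) * w"
    by simp
  have "fps_pow (SV_base x) y = fps_binomial (- y) oo (- w)"
    unfolding SV_base_eq_compose[OF assms] w_def[symmetric]
    by (subst fps_pow_compose) (simp_all add: w0 fps_pow_inverse_one_plus_X)
  \<comment> \<open>The binomial coefficient is (-1)^j \<open>pochhammer y j\<close> / j!; its sign
    cancels that of (-w)^j, its j! the one in the coefficient of w^j.\<close>
  moreover have "(- y gchoose j) * (- w) ^ j $ n =
      of_nat (Stirling n j) * (x - 1) ^ (n - j) * pochhammer y j / fact n" for j
  proof -
    have "(- w) ^ j $ n = (-1) ^ j * w ^ j $ n"
      by (cases "even j") simp_all
    then show ?thesis
      by (simp add: fps_power_nth_Stirling[OF w0 w'] gbinomial_pochhammer power_mult_distrib[symmetric])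
  qed
  ultimately show ?thesis
    by (simp add: fps_compose_nth sum_distrib_left)
qed

text \<open>Used at both levels of \<open>poly2_eval\<close>: for \<open>of_rat\<close> on the inner
  coefficients and for inner evaluation on the outer ones.\<close>

lemma map_poly_mult_hom:
  fixes h :: "'a::comm_semiring_0 \<Rightarrow> 'b::comm_semiring_0"
  assumes [simp]: "h 0 = 0" and add: "\<And>a b. h (a + b) = h a + h b"
    and mult: "\<And>a b. h (a * b) = h a * h b"
  shows "map_poly h (p * q) = map_poly h p * map_poly h q"
proof -
  have "h (sum f A) = (\<Sum>i\<in>A. h (f i))" for f :: "nat \<Rightarrow> 'a" and A
    by (induction A rule: infinite_finite_induct) (simp_all add: add)
  then show ?thesis
    by (intro poly_eqI) (simp add: coeff_map_poly coeff_mult mult)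
qed

lemma map_poly_add_hom:
  assumes "h 0 = 0" "\<And>a b. h (a + b) = h a + h b"
  shows "map_poly h (p + q) = map_poly h p + map_poly h q"
  by (intro poly_eqI) (simp add: coeff_map_poly assms)

text \<open>This and the following rules let the simplifier evaluate an explicit polynomial
  expression term by term.\<close>

lemma poly2_eval_0 [simp]: "poly2_eval 0 a b = 0"
  by (simp add: poly2_eval_def)

lemma poly2_eval_1 [simp]: "poly2_eval 1 a b = 1"
  by (simp add: poly2_eval_def one_pCons map_poly_pCons)

lemma poly2_eval_add [simp]: "poly2_eval (p + q) a b = poly2_eval p a b + poly2_eval q a b"
  unfolding poly2_eval_def
  by (subst map_poly_add_hom) (simp_all add: map_poly_add_hom of_rat_add)

lemma poly2_eval_mult [simp]: "poly2_eval (p * q) a b = poly2_eval p a b * poly2_eval q a b"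
  unfolding poly2_eval_def
  by (subst map_poly_mult_hom)
    (simp_all add: map_poly_add_hom map_poly_mult_hom of_rat_add of_rat_mult)

lemma poly2_eval_of_nat [simp]: "poly2_eval (of_nat n) a b = of_nat n"
  by (induction n) simp_all

lemma poly2_eval_power [simp]: "poly2_eval (p ^ n) a b = poly2_eval p a b ^ n"
  by (induction n) simp_all

lemma poly2_eval_sum [simp]: "poly2_eval (sum f A) a b = (\<Sum>i\<in>A. poly2_eval (f i) a b)"
  by (induction A rule: infinite_finite_induct) simp_all

lemma poly2_eval_outer_var [simp]: "poly2_eval [:0, 1:] a b = b"
  by (simp add: poly2_eval_def map_poly_pCons)

lemma poly2_eval_inner_var_minus_1 [simp]: "poly2_eval [:[:-1, 1:]:] a b = a - 1"
  by (simp add: poly2_eval_def map_poly_pCons)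

lemma to_fract_power: "to_fract (p ^ n) = to_fract p ^ n"
  by (induction n) simp_all

text \<open>The computation takes place in the fraction field, where x - 1 is invertible, and
  returns to polynomials by injectivity of \<open>to_fract\<close>. The formula has no denominator
  in x - 1, so it can be evaluated at any point.\<close>

lemma SV_poly_eq:
  "SV_poly n = (\<Sum>j=0..n. of_nat (Stirling n j) * [:[:-1, 1:]:] ^ (n - j) *
     (\<Sum>m\<le>j. of_nat (stirling j m) * [:0, 1:] ^ m))" (is "_ = ?P")
proof -
  have "to_fract (SV_poly n) = fact n * SV_egf $ n"
    using to_fract_SV_poly[of n] by (simp add: field_simps)
  also have "\<dots> = (\<Sum>j=0..n. of_nat (Stirling n j) * (ind1 - 1) ^ (n - j) * pochhammer ind2 j)"
    unfolding SV_egf_def by (rule fps_pow_SV_base_nth[OF ind1_neq_1])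
  also have "ind1 - 1 = to_fract [:[:-1, 1:]:]"
    unfolding ind1_def by (simp add: one_pCons flip: to_fract_1 to_fract_diff)
  finally have "to_fract (SV_poly n) = to_fract ?P"
    by (simp add: stirling_pochhammer[symmetric] to_fract_sum to_fract_power of_nat_to_fract ind2_def)
  then show ?thesis by (simp only: to_fract_eq_iff)
qed

text \<open>Set y = 1/k in \<open>SV_poly_eq\<close>; since m \<le> n and k is nonzero, k^n (1/k)^m
  = k^(n-m).\<close>

lemma inv_k_Eulerian_eq:
  fixes x k :: "'a::field_char_0"
  assumes "k \<noteq> 0"
  shows "inv_k_Eulerian n k x =
    (\<Sum>m=0..n. \<Sum>j=0..n. of_nat (Stirling n j) * (x - 1) ^ (n - j) *
       of_nat (stirling j m) * k ^ (n - m))"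
proof -
  \<comment> \<open>The added terms vanish because |s_{j,m}| = 0 for m > j; the range of m no longer
    depends on j, so the sums can be swapped.\<close>
  have extend: "(\<Sum>m\<le>j. of_nat (stirling j m) * (1 / k) ^ m) =
      (\<Sum>m=0..n. of_nat (stirling j m) * (1 / k) ^ m)" if "j \<le> n" for j
    using that by (intro sum.mono_neutral_left) auto
  have "inv_k_Eulerian n k x = k ^ n * (\<Sum>j=0..n. of_nat (Stirling n j) * (x - 1) ^ (n - j) *
      (\<Sum>m=0..n. of_nat (stirling j m) * (1 / k) ^ m))"
    by (simp add: inv_k_Eulerian_def SV_poly_eq extend)
  also have "\<dots> = (\<Sum>j=0..n. \<Sum>m=0..n. of_nat (Stirling n j) * (x - 1) ^ (n - j) *
       of_nat (stirling j m) * (k ^ n * (1 / k) ^ m))"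
    by (simp add: sum_distrib_left mult_ac)
  also have "\<dots> = (\<Sum>j=0..n. \<Sum>m=0..n. of_nat (Stirling n j) * (x - 1) ^ (n - j) *
       of_nat (stirling j m) * k ^ (n - m))"
    using assms by (intro sum.cong refl) (simp add: power_diff field_simps)
  finally show ?thesis
    by (subst sum.swap)
qed

text \<open>Here x and k are the two indeterminates inside their field of rational functions, where
  1/k exists. \<open>ind2\<close>, which served as y in \<open>SV_egf\<close>, now plays k.\<close>

theorem mainTheorem12:
  fixes n :: nat
  shows "inv_k_Eulerian n ind2 ind1 =
    (\<Sum>m=0..n. \<Sum>j=0..n. of_nat (Stirling n j) * (ind1 - 1) ^ (n - j) *
       of_nat (stirling j m) * ind2 ^ (n - m))"
proof (rule inv_k_Eulerian_eq)
  show "ind2 \<noteq> 0" by (simp add: ind2_def)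
qed

end
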